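(* The inference system $\mathbf{ReC}^{\to}$ admits equational derivability (ED). That is, for every substitution $\theta$, every set of equations $\mathcal{C}$, every equation $l\simeq r$ and every clause $D[l\theta]$: if $\mathcal{C}\vdash^*_{\mathbf{ReC}^{\to}} D[l\theta]$, then $\mathcal{C},\,l\simeq r\vdash^*_{\mathbf{ReC}^{\to}} D[r\theta]$.
   Context: Setting: (many-sorted) first-order logic with equality $\simeq$. Equations are unordered, so a rule stated for $l\simeq r$ can be applied with either side as $l$. $\bowtie$ stands for $\simeq$ or $\not\simeq$. A clause is a disjunction of literals. $E[s]_p$ denotes an expression $E$ with a distinguished occurrence of the term $s$ at position $p$ ($p$ omitted if irrelevant), and $E[t]_p$ is the result of replacing this occurrence by $t$. $\succ$ is a fixed reduction ordering (well-founded, stable under substitutions and contexts) that is total on ground terms; it is extended to literals and clauses by the bag (multiset) extension. A literal selection function satisfying the usual condition w.r.t. $\succ$ for superposition is fixed. For an inference system $\mathcal{I}$, $\mathcal{C}\vdash^*_{\mathcal{I}}D$ means that $D$ is derivable from the clauses $\mathcal{C}$ by finitely many inferences of $\mathcal{I}$. A position is a finite sequence of positive integers; $\epsilon$ is the empty one. $p<_l q$ ("$p$ is to the left of $q$") if there are positive integers $i<j$ and positions $r,p',q'$ with $p=rip'$ and $q=rjq'$. Every clause carries a position annotation: ${}_pC$ means that the previous rewrite producing $C$ took place at position $p$. Input clauses carry $\epsilon$. An unannotated clause counts as derivable if it is derivable with some position annotation. $\mathbf{ReC}^{\to}$ consists of the following rules. (Sup) From ${}_p(s[u]\bowtie t\lor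 C)$ and ${}_q(l\simeq r\lor D)$ (displayed literals selected) infer ${}_\epsilon(s[r]\bowtie t\lor C\lor D)\theta$, where $u$ is not a variable, $\theta=\mathrm{mgu}(l,u)$, $r\theta\not\succeq l\theta$ and $t\theta\not\succeq s\theta$. (EqRes) From ${}_p(s\not\simeq t\lor C)$ ($s\not\simeq t$ selected) infer ${}_\epsilon C\theta$, where $\theta=\mathrm{mgu}(s,t)$. (EqFac) From ${}_p(s\simeq t\lor u\simeq w\lor C)$ (both displayed literals selected) infer ${}_\epsilon(s\simeq t\lor t\not\simeq w\lor C)\theta$, where $\theta=\mathrm{mgu}(s,u)$, $t\theta\not\succeq s\theta$ and $w\theta\not\succeq t\theta$. ($\mathrm{Rw}^{\to}$) From ${}_pC[l\theta]_q$ and ${}_{p'}(l\simeq r)$ infer ${}_qC[r\theta]_q$, where $\theta$ is any substitution and $q\not<_l p$. *)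

theory Defs
  imports "HOL-Library.Multiset" "HOL-Library.Uprod"
begin

section \<open>Many-sorted terms\<close>

datatype (funs: 'f, vars: 'v) trm = Var 'v | Fun 'f "('f, 'v) trm list"

text \<open>A variable is a pair of its sort and an index, so every sort has infinitely many variables.
  A signature maps a function symbol to its argument sorts and its result sort.\<close>

type_synonym ('f, 's) sterm = "('f, 's \<times> nat) trm"
type_synonym ('f, 's) sig = "'f \<Rightarrow> 's list \<times> 's"
type_synonym ('f, 's) subst = "'s \<times> nat \<Rightarrow> ('f, 's) sterm"

inductive has_sort :: "('f, 's) sig \<Rightarrow> ('f, 's) sterm \<Rightarrow> 's \<Rightarrow> bool" for \<Sigma> where
  "has_sort \<Sigma> (Var x) (fst x)"
| "\<Sigma> f = (\<sigma>s, \<sigma>) \<Longrightarrow> list_all2 (has_sort \<Sigma>) ts \<sigma>s \<Longrightarrow> has_sort \<Sigma> (Fun f ts) \<sigma>"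

definition well_sorted :: "('f, 's) sig \<Rightarrow> ('f, 's) sterm \<Rightarrow> bool" where
  "well_sorted \<Sigma> t \<longleftrightarrow> (\<exists>\<sigma>. has_sort \<Sigma> t \<sigma>)"

definition ground :: "('f, 's) sterm \<Rightarrow> bool" where
  "ground t \<longleftrightarrow> vars t = {}"

primrec subst_trm :: "('f, 's) sterm \<Rightarrow> ('f, 's) subst \<Rightarrow> ('f, 's) sterm" (infixl "\<cdot>" 67) where
  "Var x \<cdot> \<theta> = \<theta> x"
| "Fun f ts \<cdot> \<theta> = Fun f (map (\<lambda>t. t \<cdot> \<theta>) ts)"

definition is_subst :: "('f, 's) sig \<Rightarrow> ('f, 's) subst \<Rightarrow> bool" where
  "is_subst \<Sigma> \<theta> \<longleftrightarrow> (\<forall>x. has_sort \<Sigma> (\<theta> x) (fst x))"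

definition is_renaming :: "('f, 's) subst \<Rightarrow> bool" where
  "is_renaming \<rho> \<longleftrightarrow> (\<exists>f. inj f \<and> (\<forall>x. fst (f x) = fst x \<and> \<rho> x = Var (f x)))"

definition is_mgu :: "('f, 's) sig \<Rightarrow> ('f, 's) subst \<Rightarrow> ('f, 's) sterm \<Rightarrow> ('f, 's) sterm \<Rightarrow> bool" where
  "is_mgu \<Sigma> \<theta> s t \<longleftrightarrow> is_subst \<Sigma> \<theta> \<and> s \<cdot> \<theta> = t \<cdot> \<theta> \<and>
    (\<forall>\<tau>. is_subst \<Sigma> \<tau> \<and> s \<cdot> \<tau> = t \<cdot> \<tau> \<longrightarrow> (\<exists>\<delta>. is_subst \<Sigma> \<delta> \<and> (\<forall>x. \<tau> x = \<theta> x \<cdot> \<delta>)))"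

section \<open>Positions\<close>

text \<open>Entries of a position are counted from 1; indices that do not exist give \<^const>\<open>None\<close>
  and make a replacement the identity.\<close>

type_synonym pos = "nat list"

fun subt_at :: "('f, 'v) trm \<Rightarrow> pos \<Rightarrow> ('f, 'v) trm option" where
  "subt_at t [] = Some t"
| "subt_at (Var x) (i # p) = None"
| "subt_at (Fun f ts) (i # p) =
    (if 1 \<le> i \<and> i \<le> length ts then subt_at (ts ! (i - 1)) p else None)"

fun replace_at :: "('f, 'v) trm \<Rightarrow> pos \<Rightarrow> ('f, 'v) trm \<Rightarrow> ('f, 'v) trm" where
  "replace_at t [] u = u"
| "replace_at (Var x) (i # p) u = Var x"
| "replace_at (Fun f ts) (i # p) u =
    (if 1 \<le> i \<and> i \<le> length ts then Fun f (ts[i - 1 := replace_at (ts ! (i - 1)) p u])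
     else Fun f ts)"

definition left_of :: "pos \<Rightarrow> pos \<Rightarrow> bool" (infix "<\<^sub>l" 50) where
  "p <\<^sub>l q \<longleftrightarrow> (\<exists>i j r p' q'. 0 < i \<and> i < j \<and> p = r @ i # p' \<and> q = r @ j # q')"

section \<open>Literals and clauses\<close>

text \<open>Equations are unordered and clauses are multisets of literals. The Boolean is the sign.\<close>

datatype ('f, 's) literal = Lit (positive: bool) (sides: "('f, 's) sterm uprod")

type_synonym ('f, 's) clause = "('f, 's) literal multiset"

abbreviation Eq :: "('f, 's) sterm \<Rightarrow> ('f, 's) sterm \<Rightarrow> ('f, 's) literal" (infix "\<approx>" 55) where
  "s \<approx> t \<equiv> Lit True (Upair s t)"

abbreviation Neq :: "('f, 's) sterm \<Rightarrow> ('f, 's) sterm \<Rightarrow> ('f, 's) literal" (infix "!\<approx>" 55) where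
  "s !\<approx> t \<equiv> Lit False (Upair s t)"

definition subst_clause :: "('f, 's) clause \<Rightarrow> ('f, 's) subst \<Rightarrow> ('f, 's) clause" (infixl "\<cdot>\<^sub>c" 67) where
  "C \<cdot>\<^sub>c \<theta> = image_mset (\<lambda>L. Lit (positive L) (map_uprod (\<lambda>t. t \<cdot> \<theta>) (sides L))) C"

definition vars_clause :: "('f, 's) clause \<Rightarrow> ('s \<times> nat) set" where
  "vars_clause C = (\<Union>L\<in>set_mset C. \<Union>t\<in>set_uprod (sides L). vars t)"

definition well_sorted_clause :: "('f, 's) sig \<Rightarrow> ('f, 's) clause \<Rightarrow> bool" where
  "well_sorted_clause \<Sigma> C \<longleftrightarrow> (\<forall>L\<in>#C. \<exists>\<sigma>. \<forall>t\<in>set_uprod (sides L). has_sort \<Sigma> t \<sigma>)"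

definition is_equation :: "('f, 's) clause \<Rightarrow> bool" where
  "is_equation C \<longleftrightarrow> (\<exists>s t. C = {#s \<approx> t#})"

text \<open>Positions in a clause refer to a way of writing it down: an arrangement fixes the order of
  the literals and of the two sides of each literal. The position \<open>i # j # p\<close> is position \<open>p\<close> in
  side \<open>j\<close> (1 or 2) of the \<open>i\<close>-th literal, also when there is only one literal.\<close>

datatype ('f, 's) alit = ALit bool "('f, 's) sterm" "('f, 's) sterm"

type_synonym ('f, 's) arrangement = "('f, 's) alit list"

primrec literal_of :: "('f, 's) alit \<Rightarrow> ('f, 's) literal" where
  "literal_of (ALit b s t) = Lit b (Upair s t)"

definition clause_of :: "('f, 's) arrangement \<Rightarrow> ('f, 's) clause" where
  "clause_of A = image_mset literal_of (mset A)"

fun subt_at_lit :: "('f, 's) alit \<Rightarrow> pos \<Rightarrow> ('f, 's) sterm option" where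
  "subt_at_lit L [] = None"
| "subt_at_lit (ALit b s t) (j # p) =
    (if j = 1 then subt_at s p else if j = 2 then subt_at t p else None)"

fun replace_at_lit :: "('f, 's) alit \<Rightarrow> pos \<Rightarrow> ('f, 's) sterm \<Rightarrow> ('f, 's) alit" where
  "replace_at_lit L [] u = L"
| "replace_at_lit (ALit b s t) (j # p) u =
    (if j = 1 then ALit b (replace_at s p u) t
     else if j = 2 then ALit b s (replace_at t p u) else ALit b s t)"

fun subt_at_cl :: "('f, 's) arrangement \<Rightarrow> pos \<Rightarrow> ('f, 's) sterm option" where
  "subt_at_cl A [] = None"
| "subt_at_cl A (i # p) =
    (if 1 \<le> i \<and> i \<le> length A then subt_at_lit (A ! (i - 1)) p else None)"

fun replace_at_cl :: "('f, 's) arrangement \<Rightarrow> pos \<Rightarrow> ('f, 's) sterm \<Rightarrow> ('f, 's) arrangement" where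
  "replace_at_cl A [] u = A"
| "replace_at_cl A (i # p) u =
    (if 1 \<le> i \<and> i \<le> length A then A[i - 1 := replace_at_lit (A ! (i - 1)) p u] else A)"

section \<open>Orderings and literal selection\<close>

text \<open>The first conjunct makes \<open>gt\<close> a relation on the well-sorted terms. Only terms of the same
  sort can be exchanged in a context.\<close>

definition reduction_ordering ::
  "('f, 's) sig \<Rightarrow> (('f, 's) sterm \<Rightarrow> ('f, 's) sterm \<Rightarrow> bool) \<Rightarrow> bool" where
  "reduction_ordering \<Sigma> gt \<longleftrightarrow>
    (\<forall>s t. gt s t \<longrightarrow> well_sorted \<Sigma> s \<and> well_sorted \<Sigma> t) \<and>
    transp gt \<and> wfp (\<lambda>s t. gt t s) \<and>
    (\<forall>s t \<theta>. gt s t \<and> is_subst \<Sigma> \<theta> \<longrightarrow> gt (s \<cdot> \<theta>) (t \<cdot> \<theta>)) \<and>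
    (\<forall>s t \<sigma> u p. gt s t \<and> has_sort \<Sigma> s \<sigma> \<and> has_sort \<Sigma> t \<sigma> \<and> well_sorted \<Sigma> u \<and>
      subt_at u p = Some s \<longrightarrow> gt u (replace_at u p t))"

definition total_on_ground ::
  "('f, 's) sig \<Rightarrow> (('f, 's) sterm \<Rightarrow> ('f, 's) sterm \<Rightarrow> bool) \<Rightarrow> bool" where
  "total_on_ground \<Sigma> gt \<longleftrightarrow> totalp_on {t. well_sorted \<Sigma> t \<and> ground t} gt"

lift_definition mset_uprod :: "'a uprod \<Rightarrow> 'a multiset" is "\<lambda>(s, t). {#s, t#}"
  by auto

lemma mset_uprod_Upair [simp]: "mset_uprod (Upair s t) = {#s, t#}"
  by transfer simp

text \<open>A positive literal with sides \<open>s\<close>, \<open>t\<close> is compared as the bag \<open>{s, t}\<close>, a negative one as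
  \<open>{s, s, t, t}\<close>.\<close>

definition bag :: "('f, 's) literal \<Rightarrow> ('f, 's) sterm multiset" where
  "bag L = (let M = mset_uprod (sides L) in if positive L then M else M + M)"

definition gt_lit :: "(('f, 's) sterm \<Rightarrow> ('f, 's) sterm \<Rightarrow> bool) \<Rightarrow>
    ('f, 's) literal \<Rightarrow> ('f, 's) literal \<Rightarrow> bool" where
  "gt_lit gt L K \<longleftrightarrow> multp (\<lambda>s t. gt t s) (bag K) (bag L)"

text \<open>The usual condition on selection: some negative literal is selected, or all (occurrences of)
  maximal literals are. For a nonempty clause either alternative makes the selection nonempty.\<close>

definition selection_function :: "('f, 's) sig \<Rightarrow> (('f, 's) sterm \<Rightarrow> ('f, 's) sterm \<Rightarrow> bool) \<Rightarrow>
    (('f, 's) clause \<Rightarrow> ('f, 's) clause) \<Rightarrow> bool" where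
  "selection_function \<Sigma> gt sel \<longleftrightarrow> (\<forall>C. well_sorted_clause \<Sigma> C \<longrightarrow>
    sel C \<subseteq># C \<and>
    ((\<exists>L\<in>#sel C. \<not> positive L) \<or>
     (\<forall>L\<in>#C. (\<forall>K\<in>#C. \<not> gt_lit gt K L) \<longrightarrow> count (sel C) L = count C L)))"

section \<open>The calculus\<close>

text \<open>\<open>ReC \<Sigma> gt sel \<C> p A\<close> says that the clause arranged as \<open>A\<close> is derivable from \<open>\<C>\<close> with position
  annotation \<open>p\<close>. Input clauses and the conclusions of \<open>sup\<close>, \<open>eq_res\<close> and \<open>eq_fac\<close>, all annotated
  with the empty position, may be written in any arrangement; \<open>rw\<close> keeps the arrangement of its
  first premise. The premises of \<open>sup\<close> are renamed apart by \<open>\<rho>\<close> and \<open>\<rho>'\<close>.\<close>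

inductive ReC :: "('f, 's) sig \<Rightarrow> (('f, 's) sterm \<Rightarrow> ('f, 's) sterm \<Rightarrow> bool) \<Rightarrow>
    (('f, 's) clause \<Rightarrow> ('f, 's) clause) \<Rightarrow> ('f, 's) clause set \<Rightarrow>
    pos \<Rightarrow> ('f, 's) arrangement \<Rightarrow> bool"
  for \<Sigma> gt sel \<C> where
  input: "clause_of A \<in> \<C> \<Longrightarrow> ReC \<Sigma> gt sel \<C> [] A"
| sup: "ReC \<Sigma> gt sel \<C> p A \<Longrightarrow> ReC \<Sigma> gt sel \<C> q B \<Longrightarrow>
    clause_of A = add_mset (Lit b (Upair s t)) C \<Longrightarrow> Lit b (Upair s t) \<in># sel (clause_of A) \<Longrightarrow>
    clause_of B = add_mset (l \<approx> r) D \<Longrightarrow> l \<approx> r \<in># sel (clause_of B) \<Longrightarrow>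
    is_renaming \<rho> \<Longrightarrow> is_renaming \<rho>' \<Longrightarrow>
    vars_clause (clause_of A \<cdot>\<^sub>c \<rho>) \<inter> vars_clause (clause_of B \<cdot>\<^sub>c \<rho>') = {} \<Longrightarrow>
    subt_at s \<pi> = Some u \<Longrightarrow> \<not> (\<exists>x. u = Var x) \<Longrightarrow>
    is_mgu \<Sigma> \<theta> (l \<cdot> \<rho>') (u \<cdot> \<rho>) \<Longrightarrow>
    \<not> gt\<^sup>=\<^sup>= (r \<cdot> \<rho>' \<cdot> \<theta>) (l \<cdot> \<rho>' \<cdot> \<theta>) \<Longrightarrow> \<not> gt\<^sup>=\<^sup>= (t \<cdot> \<rho> \<cdot> \<theta>) (s \<cdot> \<rho> \<cdot> \<theta>) \<Longrightarrow>
    clause_of E =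
      (add_mset (Lit b (Upair (replace_at (s \<cdot> \<rho>) \<pi> (r \<cdot> \<rho>')) (t \<cdot> \<rho>))) (C \<cdot>\<^sub>c \<rho> + D \<cdot>\<^sub>c \<rho>')) \<cdot>\<^sub>c \<theta> \<Longrightarrow>
    ReC \<Sigma> gt sel \<C> [] E"
| eq_res: "ReC \<Sigma> gt sel \<C> p A \<Longrightarrow>
    clause_of A = add_mset (s !\<approx> t) C \<Longrightarrow> s !\<approx> t \<in># sel (clause_of A) \<Longrightarrow>
    is_mgu \<Sigma> \<theta> s t \<Longrightarrow>
    clause_of E = C \<cdot>\<^sub>c \<theta> \<Longrightarrow>
    ReC \<Sigma> gt sel \<C> [] E"
| eq_fac: "ReC \<Sigma> gt sel \<C> p A \<Longrightarrow>
    clause_of A = {#s \<approx> t, u \<approx> w#} + C \<Longrightarrow> {#s \<approx> t, u \<approx> w#} \<subseteq># sel (clause_of A) \<Longrightarrow>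
    is_mgu \<Sigma> \<theta> s u \<Longrightarrow>
    \<not> gt\<^sup>=\<^sup>= (t \<cdot> \<theta>) (s \<cdot> \<theta>) \<Longrightarrow> \<not> gt\<^sup>=\<^sup>= (w \<cdot> \<theta>) (t \<cdot> \<theta>) \<Longrightarrow>
    clause_of E = ({#s \<approx> t, t !\<approx> w#} + C) \<cdot>\<^sub>c \<theta> \<Longrightarrow>
    ReC \<Sigma> gt sel \<C> [] E"
| rw: "ReC \<Sigma> gt sel \<C> p A \<Longrightarrow> ReC \<Sigma> gt sel \<C> p' B \<Longrightarrow> clause_of B = {#l \<approx> r#} \<Longrightarrow>
    is_subst \<Sigma> \<theta> \<Longrightarrow> subt_at_cl A q = Some (l \<cdot> \<theta>) \<Longrightarrow> \<not> q <\<^sub>l p \<Longrightarrow>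
    ReC \<Sigma> gt sel \<C> q (replace_at_cl A q (r \<cdot> \<theta>))"

definition ReC_derivable :: "('f, 's) sig \<Rightarrow> (('f, 's) sterm \<Rightarrow> ('f, 's) sterm \<Rightarrow> bool) \<Rightarrow>
    (('f, 's) clause \<Rightarrow> ('f, 's) clause) \<Rightarrow> ('f, 's) clause set \<Rightarrow> ('f, 's) clause \<Rightarrow> bool" where
  "ReC_derivable \<Sigma> gt sel \<C> D \<longleftrightarrow> (\<exists>p A. clause_of A = D \<and> ReC \<Sigma> gt sel \<C> p A)"

text \<open>An inference system enters through its derivability relation; the arrangement \<open>D\<close> serves to
  point at the occurrence of \<open>l \<cdot> \<theta>\<close> in the clause.\<close>

definition admits_ED :: "('f, 's) sig \<Rightarrow>
    (('f, 's) clause set \<Rightarrow> ('f, 's) clause \<Rightarrow> bool) \<Rightarrow> bool" where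
  "admits_ED \<Sigma> derivable \<longleftrightarrow> (\<forall>\<theta> \<C> l r D q.
    is_subst \<Sigma> \<theta> \<longrightarrow>
    (\<forall>C\<in>\<C>. is_equation C \<and> well_sorted_clause \<Sigma> C) \<longrightarrow>
    well_sorted_clause \<Sigma> {#l \<approx> r#} \<longrightarrow>
    subt_at_cl D q = Some (l \<cdot> \<theta>) \<longrightarrow>
    derivable \<C> (clause_of D) \<longrightarrow>
    derivable (insert {#l \<approx> r#} \<C>) (clause_of (replace_at_cl D q (r \<cdot> \<theta>))))"

end

theory Submission
  imports Defs
begin

text \<open>A rewrite step at \<open>q\<close> that would be blocked by the annotation \<open>p\<close> of the current clause is
  strictly to the left of \<open>p\<close>, hence parallel to the step at \<open>p\<close>, and so it can be carried out
  before that step. Doing so never blocks the step at \<open>p\<close> itself: the new annotation of its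
  premise is either the old one or \<open>q\<close>, and \<open>p\<close> is not to the left of \<open>q\<close>. Pushing the step further
  up in this way ends at the latest at a clause with the empty annotation, which blocks nothing.\<close>

text \<open>Below the common prefix \<open>c\<close> the two positions enter different arguments.
  The shape is the one that unfolding \<open>left_of\<close> produces; the symmetric condition
  \<open>i \<noteq> j\<close> lets the fact be used with either step as the earlier one.\<close>

lemma subt_at_replace_at_parallel:
  assumes "i \<noteq> j"
  shows "subt_at (replace_at t (c @ i # p) u) (c @ j # q) = subt_at t (c @ j # q)"
  using assms
proof (induction c arbitrary: t)
  case Nil
  then show ?case by (cases t) (auto simp: nth_list_update)
next
  case (Cons k c)
  then show ?case by (cases t) auto
qed

lemma replace_at_commute:
  assumes "i \<noteq> j"
  shows "replace_at (replace_at t (c @ i # p) u) (c @ j # q) v =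
    replace_at (replace_at t (c @ j # q) v) (c @ i # p) u"
  using assms
proof (induction c arbitrary: t)
  case Nil
  then show ?case by (cases t) (auto simp: nth_list_update intro!: list_update_swap)
next
  case (Cons k c)
  then show ?case by (cases t) auto
qed

lemma subt_at_lit_replace_at_lit_parallel:
  assumes "i \<noteq> j"
  shows "subt_at_lit (replace_at_lit L (c @ i # p) u) (c @ j # q) = subt_at_lit L (c @ j # q)"
  using assms by (cases L; cases c) (auto simp: subt_at_replace_at_parallel)

lemma replace_at_lit_commute:
  assumes "i \<noteq> j"
  shows "replace_at_lit (replace_at_lit L (c @ i # p) u) (c @ j # q) v =
    replace_at_lit (replace_at_lit L (c @ j # q) v) (c @ i # p) u"
  using assms by (cases L; cases c) (auto simp: replace_at_commute)

lemma subt_at_cl_replace_at_cl_parallel: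
  assumes "i \<noteq> j"
  shows "subt_at_cl (replace_at_cl A (c @ i # p) u) (c @ j # q) = subt_at_cl A (c @ j # q)"
  using assms
  by (cases c) (auto simp: nth_list_update subt_at_lit_replace_at_lit_parallel)

lemma replace_at_cl_commute:
  assumes "i \<noteq> j"
  shows "replace_at_cl (replace_at_cl A (c @ i # p) u) (c @ j # q) v =
    replace_at_cl (replace_at_cl A (c @ j # q) v) (c @ i # p) u"
  using assms
  by (cases c) (auto simp: nth_list_update replace_at_lit_commute intro!: list_update_swap)

lemma not_left_of_Nil [simp]: "\<not> p <\<^sub>l []"
  by (simp add: left_of_def)

text \<open>Two positions have only one place where they first differ, so both decompositions split
  there, with opposite orders of the entries.\<close>

lemma left_of_asym:
  assumes "p <\<^sub>l q"
  shows "\<not> q <\<^sub>l p"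
proof
  assume "q <\<^sub>l p"
  then obtain i j c p1 q1 where ij: "i < j" "q = c @ i # q1" "p = c @ j # p1"
    unfolding left_of_def by blast
  from assms obtain i' j' c' p2 q2 where ij': "i' < j'" "p = c' @ i' # p2" "q = c' @ j' # q2"
    unfolding left_of_def by blast
  have "c @ i # q1 = c' @ j' # q2" "c @ j # p1 = c' @ i' # p2"
    using ij ij' by auto
  \<comment> \<open>Induction on \<open>c\<close> forces \<open>c' = c\<close>: were one prefix
    shorter, the entries right after it would have to be equal.\<close>
  then have "i = j' \<and> j = i'"
    using ij(1) ij'(1)
  proof (induction c arbitrary: c')
    case Nil
    then show ?case by (cases c') auto
  next
    case (Cons k c)
    then show ?case by (cases c') auto
  qed
  with ij(1) ij'(1) show False by simp
qed

lemma ReC_mono: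
  assumes "ReC \<Sigma> gt sel \<C> p A" and "\<C> \<subseteq> \<C>'"
  shows "ReC \<Sigma> gt sel \<C>' p A"
  using assms(1)
proof (induction rule: ReC.induct)
  case (input A)
  with assms(2) show ?case by (auto intro: ReC.input)
next
  case sup
  show ?case by (rule ReC.sup[OF sup.IH sup.hyps(3-)])
next
  case eq_res
  show ?case by (rule ReC.eq_res[OF eq_res.IH eq_res.hyps(2-)])
next
  case eq_fac
  show ?case by (rule ReC.eq_fac[OF eq_fac.IH eq_fac.hyps(2-)])
next
  case rw
  show ?case by (rule ReC.rw[OF rw.IH rw.hyps(3-)])
qed

text \<open>Induction on the derivation of \<open>A\<close>. Confining the new annotation to
  \<open>p\<close> and \<open>q\<close> is what makes the induction work: it is \<open>q\<close> if
  the new step comes last, and \<open>p\<close> if it was moved ahead of the last step, which is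
  then redone.\<close>

lemma ReC_rewrite:
  assumes "ReC \<Sigma> gt sel \<C> p A"
    and eqn: "ReC \<Sigma> gt sel \<C> p\<^sub>0 B" "clause_of B = {#l \<approx> r#}" "is_subst \<Sigma> \<theta>"
    and "subt_at_cl A q = Some (l \<cdot> \<theta>)"
  shows "\<exists>p'\<in>{p, q}. ReC \<Sigma> gt sel \<C> p' (replace_at_cl A q (r \<cdot> \<theta>))"
  using assms(1,5)
proof (induction rule: ReC.induct)
  case (input A)
  \<comment> \<open>Here, as after \<open>sup\<close>, \<open>eq_res\<close> and
    \<open>eq_fac\<close>, the annotation is empty and no position is to the left of it, so the step
    applies directly.\<close>
  then have "ReC \<Sigma> gt sel \<C> q (replace_at_cl A q (r \<cdot> \<theta>))"
    by (intro ReC.rw[OF ReC.input eqn]) auto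
  then show ?case by blast
next
  case (sup p A q' B' b s t C l' r' D \<rho> \<rho>' \<pi> u \<eta> E)
  have "ReC \<Sigma> gt sel \<C> [] E" by (rule ReC.sup[OF sup.hyps])
  then have "ReC \<Sigma> gt sel \<C> q (replace_at_cl E q (r \<cdot> \<theta>))"
    by (rule ReC.rw[OF _ eqn]) (use sup.prems in auto)
  then show ?case by blast
next
  case (eq_res p A s t C \<eta> E)
  have "ReC \<Sigma> gt sel \<C> [] E" by (rule ReC.eq_res[OF eq_res.hyps])
  then have "ReC \<Sigma> gt sel \<C> q (replace_at_cl E q (r \<cdot> \<theta>))"
    by (rule ReC.rw[OF _ eqn]) (use eq_res.prems in auto)
  then show ?case by blast
next
  case (eq_fac p A s t u w C \<eta> E)
  have "ReC \<Sigma> gt sel \<C> [] E" by (rule ReC.eq_fac[OF eq_fac.hyps])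
  then have "ReC \<Sigma> gt sel \<C> q (replace_at_cl E q (r \<cdot> \<theta>))"
    by (rule ReC.rw[OF _ eqn]) (use eq_fac.prems in auto)
  then show ?case by blast
next
  case (rw p A p' B' l' r' \<eta> q')
  show ?case
  proof (cases "q <\<^sub>l q'")
    case False
    have "ReC \<Sigma> gt sel \<C> q' (replace_at_cl A q' (r' \<cdot> \<eta>))" by (rule ReC.rw[OF rw.hyps])
    then have "ReC \<Sigma> gt sel \<C> q (replace_at_cl (replace_at_cl A q' (r' \<cdot> \<eta>)) q (r \<cdot> \<theta>))"
      by (rule ReC.rw[OF _ eqn]) (use rw.prems False in auto)
    then show ?thesis by blast
  next
    case True
    then obtain i j c q1 q2 where "i < j" "q = c @ i # q1" "q' = c @ j # q2"
      unfolding left_of_def by blast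
    then have ij: "i \<noteq> j" "q = c @ i # q1" "q' = c @ j # q2" by simp_all
    \<comment> \<open>The step at \<open>q'\<close> did not touch \<open>q\<close>, so the redex is
      already present in its premise and the induction hypothesis applies there.\<close>
    have "subt_at_cl A q = Some (l \<cdot> \<theta>)"
      using rw.prems ij by (simp add: subt_at_cl_replace_at_cl_parallel)
    then obtain p'' where p'': "p'' \<in> {p, q}" "ReC \<Sigma> gt sel \<C> p'' (replace_at_cl A q (r \<cdot> \<theta>))"
      using rw.IH(1) by blast
    \<comment> \<open>For \<open>p'' = p\<close> this is the side condition of the original step,
      for \<open>p'' = q\<close> it is asymmetry.\<close>
    have "\<not> q' <\<^sub>l p''"
      using p''(1) rw.hyps left_of_asym[OF True] by auto
    moreover have "subt_at_cl (replace_at_cl A q (r \<cdot> \<theta>)) q' = Some (l' \<cdot> \<eta>)"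
      using rw.hyps ij by (simp add: subt_at_cl_replace_at_cl_parallel)
    ultimately have "ReC \<Sigma> gt sel \<C> q' (replace_at_cl (replace_at_cl A q (r \<cdot> \<theta>)) q' (r' \<cdot> \<eta>))"
      using ReC.rw[OF p''(2)] rw.hyps by blast
    then show ?thesis
      using ij replace_at_cl_commute[OF ij(1), of A c q1 "r \<cdot> \<theta>" q2 "r' \<cdot> \<eta>"] by simp
  qed
qed

text \<open>Equations are unordered, so \<open>K\<close> is \<open>L\<close> or \<open>L\<close>
  with its sides swapped; the position follows the side.\<close>

lemma literal_of_eq_transfer:
  assumes "literal_of K = literal_of L" and "subt_at_lit L p = Some v"
  shows "\<exists>p'. subt_at_lit K p' = Some v \<and>
    literal_of (replace_at_lit K p' u) = literal_of (replace_at_lit L p u)"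
proof -
  obtain b s t where L: "L = ALit b s t" by (cases L)
  from assms(2) L obtain j p1 where p: "p = j # p1" by (cases p) auto
  from assms(1) L have "K = ALit b s t \<or> K = ALit b t s"
    by (cases K) auto
  then show ?thesis
  proof
    assume "K = ALit b s t"
    with assms(2) L show ?thesis by blast
  next
    assume K: "K = ALit b t s"
    \<comment> \<open>The map \<open>3 - j\<close> exchanges the side numbers 1 and 2.\<close>
    have "subt_at_lit K ((3 - j) # p1) = Some v \<and>
      literal_of (replace_at_lit K ((3 - j) # p1) u) = literal_of (replace_at_lit L p u)"
      using assms(2) by (auto simp: L K p split: if_splits)
    then show ?thesis by blast
  qed
qed

text \<open>Describes an update without its index, so that updates in different arrangements of one
  clause can be compared.\<close>

lemma clause_of_update:
  assumes "k < length A"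
  shows "clause_of (A[k := K]) =
    add_mset (literal_of K) (clause_of A - {#literal_of (A ! k)#})"
  using assms by (simp add: clause_of_def mset_update image_mset_Diff)

text \<open>Derivability supplies some arrangement \<open>A\<close> of the clause, not necessarily
  \<open>D\<close>; this carries the chosen occurrence over to \<open>A\<close>.\<close>

lemma clause_of_eq_transfer:
  assumes "clause_of A = clause_of D" and "subt_at_cl D q = Some v"
  shows "\<exists>q'. subt_at_cl A q' = Some v \<and>
    clause_of (replace_at_cl A q' u) = clause_of (replace_at_cl D q u)"
proof -
  obtain i p where q: "q = i # p" and i: "1 \<le> i" "i \<le> length D"
    and v: "subt_at_lit (D ! (i - 1)) p = Some v"
    using assms(2) by (cases q) (auto split: if_splits)
  have "literal_of (D ! (i - 1)) \<in># clause_of A"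
    using i unfolding assms(1) by (auto simp: clause_of_def)
  \<comment> \<open>If the literal occurs several times, any copy will do, since the copies are
    interchangeable in the multiset.\<close>
  then obtain k where k: "k < length A" "literal_of (A ! k) = literal_of (D ! (i - 1))"
    by (auto simp: clause_of_def in_set_conv_nth)
  obtain p' where p': "subt_at_lit (A ! k) p' = Some v"
    "literal_of (replace_at_lit (A ! k) p' u) = literal_of (replace_at_lit (D ! (i - 1)) p u)"
    using literal_of_eq_transfer[OF k(2) v] by blast
  \<comment> \<open>List indices start at 0, position entries at 1.\<close>
  have "subt_at_cl A (Suc k # p') = Some v"
    using k p' by simp
  moreover have "clause_of (replace_at_cl A (Suc k # p') u) = clause_of (replace_at_cl D q u)"
    using i k p' assms(1) by (simp add: q clause_of_update)
  ultimately show ?thesis by blast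
qed

theorem theorem3:
  fixes \<Sigma> :: "('f, 's) sig"
    and gt :: "('f, 's) sterm \<Rightarrow> ('f, 's) sterm \<Rightarrow> bool"
    and sel :: "('f, 's) clause \<Rightarrow> ('f, 's) clause"
  assumes "reduction_ordering \<Sigma> gt"
    and "total_on_ground \<Sigma> gt"
    and "selection_function \<Sigma> gt sel"
  shows "admits_ED \<Sigma> (ReC_derivable \<Sigma> gt sel)"
  unfolding admits_ED_def
proof (intro allI impI)
  fix \<theta> :: "('f, 's) subst" and \<C> l r D q
  assume \<theta>: "is_subst \<Sigma> \<theta>" and q: "subt_at_cl D q = Some (l \<cdot> \<theta>)"
    and "ReC_derivable \<Sigma> gt sel \<C> (clause_of D)"
  then obtain p A where A: "clause_of A = clause_of D" "ReC \<Sigma> gt sel \<C> p A"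
    unfolding ReC_derivable_def by blast
  let ?\<C> = "insert {#l \<approx> r#} \<C>"
  obtain q' where q': "subt_at_cl A q' = Some (l \<cdot> \<theta>)"
    "clause_of (replace_at_cl A q' (r \<cdot> \<theta>)) = clause_of (replace_at_cl D q (r \<cdot> \<theta>))"
    using clause_of_eq_transfer[OF A(1) q] by blast
  have B: "clause_of [ALit True l r] = {#l \<approx> r#}"
    by (simp add: clause_of_def)
  \<comment> \<open>The new equation is itself an input clause, so it can serve as the second
    premise of \<open>rw\<close>.\<close>
  then have "ReC \<Sigma> gt sel ?\<C> [] [ALit True l r]"
    by (intro ReC.input) simp
  from ReC_rewrite[OF ReC_mono[OF A(2)] this B \<theta> q'(1)]
  obtain p' where "ReC \<Sigma> gt sel ?\<C> p' (replace_at_cl A q' (r \<cdot> \<theta>))"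
    by blast
  with q'(2) show "ReC_derivable \<Sigma> gt sel ?\<C> (clause_of (replace_at_cl D q (r \<cdot> \<theta>)))"
    unfolding ReC_derivable_def by blast
qed

end
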